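(* Let $n\ge 4$. Then $-4$ is an eigenvalue of the $n$-Queens' graph $\mathcal{Q}(n)$ with multiplicity $(n-3)^2$, and the family $\mathcal{F}_n=\{X_n^{(a,b)}\mid (a,b)\in[n-3]^2\}$ is a basis of the eigenspace $\mathcal{E}_{\mathcal{Q}(n)}(-4)$.
   Context: $[n]=\{1,\dots,n\}$. The $n$-Queens' graph $\mathcal{Q}(n)$ has vertex set $[n]^2$, and two distinct vertices $(i,j),(i',j')$ are adjacent if and only if $i=i'$, or $j=j'$, or $i+j=i'+j'$, or $i-j=i'-j'$. Vectors in $\mathbb{R}^{n^2}$ are indexed by $(i,j)\in[n]^2$. Let $X_4\in\mathbb{R}^{16}$ be the vector indexed by $[4]^2$ with $[X_4]_{(i,j)}=1$ for $(i,j)\in\{(1,2),(2,4),(3,1),(4,3)\}$, $[X_4]_{(i,j)}=-1$ for $(i,j)\in\{(1,3),(2,1),(3,4),(4,2)\}$, and $0$ otherwise. For $(a,b)\in[n-3]^2$, with $A=\{a,a+1,a+2,a+3\}$ and $B=\{b,b+1,b+2,b+3\}$, define $X_n^{(a,b)}\in\mathbb{R}^{n^2}$ by $[X_n^{(a,b)}]_{(i,j)}=[X_4]_{(i-a+1,j-b+1)}$ if $(i,j)\in A\times B$ and $0$ otherwise. *)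

theory Defs
  imports
    "Jordan_Normal_Form.Char_Poly"
    "Jordan_Normal_Form.Matrix_Kernel"
    "Graph_Theory.Pair_Digraph"
begin

definition queens_graph :: "nat \<Rightarrow> (nat \<times> nat) pair_pre_digraph" where
  "queens_graph n =
    \<lparr>pverts = {1..n} \<times> {1..n},
     parcs = {((i, j), (i', j')) | i j i' j'.
        (i, j) \<in> {1..n} \<times> {1..n} \<and> (i', j') \<in> {1..n} \<times> {1..n} \<and> (i, j) \<noteq> (i', j') \<and>
        (i = i' \<or> j = j' \<or> i + j = i' + j' \<or> int i - int j = int i' - int j')}\<rparr>"

text \<open>Matrices and vectors of the library are indexed by the numbers below their dimension.
  The squares of the board are enumerated row by row; any other enumeration would only permute
  coordinates.\<close>

definition square :: "nat \<Rightarrow> nat \<Rightarrow> nat \<times> nat" where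
  "square n k = (k div n + 1, k mod n + 1)"

lemma bij_betw_square: "bij_betw (square n) {..<n ^ 2} (pverts (queens_graph n))"
proof (rule bij_betw_imageI)
  show "inj_on (square n) {..<n ^ 2}"
    by (rule inj_onI, simp add: square_def) (metis div_mult_mod_eq)
  show "square n ` {..<n ^ 2} = pverts (queens_graph n)"
  proof (intro subset_antisym subsetI)
    fix p assume "p \<in> square n ` {..<n ^ 2}"
    then obtain k where k: "k < n * n" "p = square n k" by (auto simp: power2_eq_square)
    then have "0 < n" by (cases n) auto
    with k have "k div n < n" "k mod n < n" by (auto simp: less_mult_imp_div_less)
    with k show "p \<in> pverts (queens_graph n)" by (auto simp: square_def queens_graph_def Suc_le_eq)
  next
    fix p assume "p \<in> pverts (queens_graph n)"
    then have "1 \<le> fst p" "fst p \<le> n" "1 \<le> snd p" "snd p \<le> n"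
      by (auto simp: queens_graph_def)
    then have "p = (Suc (fst p - 1), Suc (snd p - 1))" "fst p - 1 < n" "snd p - 1 < n"
      by (auto simp: prod_eq_iff)
    then obtain i j where ij: "p = (Suc i, Suc j)" "i < n" "j < n" by blast
    have "i * n + j < Suc i * n" using ij by simp
    also have "\<dots> \<le> n * n" using ij by (intro mult_le_mono1) simp
    finally have "i * n + j < n ^ 2" by (simp add: power2_eq_square)
    moreover have "p = square n (i * n + j)" using ij by (simp add: square_def)
    ultimately show "p \<in> square n ` {..<n ^ 2}" by blast
  qed
qed

definition board_vec :: "nat \<Rightarrow> (nat \<times> nat \<Rightarrow> real) \<Rightarrow> real vec" where
  "board_vec n f = vec (n ^ 2) (\<lambda>k. f (square n k))"

definition queens_mat :: "nat \<Rightarrow> real mat" where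
  "queens_mat n = mat (n ^ 2) (n ^ 2)
     (\<lambda>(k, l). if (square n k, square n l) \<in> parcs (queens_graph n) then 1 else 0)"

definition eigenspace :: "'a :: field mat \<Rightarrow> 'a \<Rightarrow> 'a vec set" where
  "eigenspace A e = {v \<in> carrier_vec (dim_row A). A *\<^sub>v v = e \<cdot>\<^sub>v v}"

abbreviation eigenspace_module :: "'a :: field mat \<Rightarrow> 'a \<Rightarrow> ('a, 'a vec) module" where
  "eigenspace_module A e \<equiv> (module_vec TYPE('a) (dim_row A))\<lparr>carrier := eigenspace A e\<rparr>"

lemma eigenspace_eq_mat_kernel:
  assumes A: "A \<in> carrier_mat m m"
  shows "eigenspace A e = mat_kernel (char_matrix A e)"
proof -
  have "A *\<^sub>v v = e \<cdot>\<^sub>v v \<longleftrightarrow> char_matrix A e *\<^sub>v v = 0\<^sub>v m" if v: "v \<in> carrier_vec m" for v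
  proof -
    have "char_matrix A e *\<^sub>v v = A *\<^sub>v v + (- e) \<cdot>\<^sub>v v"
      using A v unfolding char_matrix_def
      by (intro eq_vecI) (auto simp: add_scalar_prod_distrib[of _ m])
    moreover have "A *\<^sub>v v + (- e) \<cdot>\<^sub>v v = 0\<^sub>v m \<longleftrightarrow> A *\<^sub>v v = e \<cdot>\<^sub>v v"
      using A v by (auto simp: vec_eq_iff)
    ultimately show ?thesis by simp
  qed
  then show ?thesis
    using A by (auto simp: eigenspace_def mat_kernel_def char_matrix_def)
qed

lemma vectorspace_eigenspace:
  assumes A: "A \<in> carrier_mat m m"
  shows "vectorspace class_ring (eigenspace_module A e)"
proof -
  interpret kernel m m "char_matrix A e" using A by unfold_locales simp
  show ?thesis
    using Ker.vectorspace_axioms assms by (simp add: eigenspace_eq_mat_kernel[OF assms])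
qed

definition X4 :: "nat \<times> nat \<Rightarrow> real" where
  "X4 p = (if p \<in> {(1, 2), (2, 4), (3, 1), (4, 3)} then 1
           else if p \<in> {(1, 3), (2, 1), (3, 4), (4, 2)} then - 1
           else 0)"

definition X_vec :: "nat \<Rightarrow> nat \<times> nat \<Rightarrow> real vec" where
  "X_vec n = (\<lambda>(a, b). board_vec n (\<lambda>(i, j).
     if i \<in> {a, a + 1, a + 2, a + 3} \<and> j \<in> {b, b + 1, b + 2, b + 3}
     then X4 (i - a + 1, j - b + 1) else 0))"

end

theory Submission
  imports
    Defs
    "Jordan_Normal_Form.Jordan_Normal_Form_Existence"
    "Jordan_Normal_Form.Jordan_Normal_Form_Uniqueness"
begin

text \<open>Each square lies on four lines (row, column, diagonal, antidiagonal) and two squares on at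
  most one, so the adjacency matrix plus 4 is a Gram matrix: its quadratic form is the sum of the
  squares of all line sums. Hence the eigenspace of -4 consists of the functions all of whose line
  sums vanish. Such a function is determined by its values at the squares (a, b + 1) with
  a, b at most n - 3, since the squares of the remaining board can be cleared one after the other.
  There the vectors X are unitriangular for the lexicographic order, so they form a basis. The
  algebraic multiplicity agrees with the dimension because the matrix is real symmetric.\<close>

section \<open>Real symmetric matrices\<close>

text \<open>Moving the matrix across the Hermitian product of an eigenvector \<open>v\<close> with
  itself shows that \<open>c\<close> and its conjugate agree as factors of
  \<open>v \<bullet>c v\<close>, which is nonzero.\<close>

lemma eigenvalue_real_of_symmetric:
  fixes A :: "real mat"
  assumes A: "A \<in> carrier_mat n n" and sym: "A\<^sup>T = A"
    and ev: "eigenvalue (map_mat complex_of_real A) c"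
  shows "c \<in> \<real>"
proof -
  let ?A = "map_mat complex_of_real A"
  have cA: "?A \<in> carrier_mat n n" using A by simp
  obtain v where v: "v \<in> carrier_vec n" "v \<noteq> 0\<^sub>v n" and Av: "?A *\<^sub>v v = c \<cdot>\<^sub>v v"
    using ev A unfolding eigenvalue_def eigenvector_def by auto
  have conj_Av: "conjugate (?A *\<^sub>v v) = ?A *\<^sub>v conjugate v"
    using A v by (intro eq_vecI) (auto simp: scalar_prod_def sum_conjugate conjugate_dist_mul)
  have "c * (v \<bullet>c v) = (?A *\<^sub>v v) \<bullet> conjugate v"
    using v by (simp add: Av)
  also have "\<dots> = v \<bullet> (?A *\<^sub>v conjugate v)"
  proof -
    have "?A\<^sup>T = ?A" using sym by (metis map_mat_transpose)
    then show ?thesis using transpose_vec_mult_scalar[OF cA, of "conjugate v" v] v by simp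
  qed
  also have "\<dots> = cnj c * (v \<bullet>c v)"
    using v conj_Av by (simp add: Av conjugate_smult_vec flip: conj_Av)
  finally have "c * (v \<bullet>c v) = cnj c * (v \<bullet>c v)" .
  moreover have "v \<bullet>c v \<noteq> 0" using v by simp
  ultimately have "c = cnj c" by (simp only: mult_cancel_right simp_thms)
  then show ?thesis by (metis Reals_cnj_iff)
qed

text \<open>The complex roots are eigenvalues, hence real, and the factorization descends since the
  embedding of polynomials is injective. Splitting over the reals gives access to a real Jordan
  normal form.\<close>

lemma char_poly_symmetric_splits:
  fixes A :: "real mat"
  assumes A: "A \<in> carrier_mat n n" and sym: "A\<^sup>T = A"
  shows "\<exists>as. char_poly A = (\<Prod>a\<leftarrow>as. [:- a, 1:])"
proof -
  let ?A = "map_mat complex_of_real A"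
  have cA: "?A \<in> carrier_mat n n" using A by simp
  interpret ph: map_poly_inj_idom_hom complex_of_real ..
  obtain cs where cs: "char_poly ?A = (\<Prod>c\<leftarrow>cs. [:- c, 1:])"
    using char_poly_factorized[OF cA] by blast
  have real: "c \<in> \<real>" if "c \<in> set cs" for c
    using that
    by (intro eigenvalue_real_of_symmetric[OF A sym])
       (auto simp: eigenvalue_root_char_poly[OF cA] cs poly_prod_list prod_list_zero_iff)
  have "map_poly complex_of_real (char_poly A) = (\<Prod>c\<leftarrow>cs. [:- c, 1:])"
    using cs by (simp only: of_real_hom.char_poly_hom[OF A])
  also have "\<dots> = (\<Prod>c\<leftarrow>cs. map_poly complex_of_real [:- Re c, 1:])"
    using real by (intro arg_cong[of _ _ prod_list] map_cong) auto
  also have "\<dots> = map_poly complex_of_real (\<Prod>a\<leftarrow>map Re cs. [:- a, 1:])"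
    by (simp add: ph.hom_prod_list o_def)
  finally show ?thesis by (blast dest: ph.injectivity)
qed

text \<open>If \<open>B * B\<close> kills \<open>v\<close>, then by symmetry the squared norm of
  \<open>B *\<^sub>v v\<close> is 0.\<close>

lemma mat_kernel_symmetric_square:
  fixes B :: "real mat"
  assumes B: "B \<in> carrier_mat n n" and sym: "B\<^sup>T = B"
  shows "mat_kernel (B * B) = mat_kernel B"
proof
  show "mat_kernel B \<subseteq> mat_kernel (B * B)" by (rule mat_kernel_mult_subset[OF B B])
  show "mat_kernel (B * B) \<subseteq> mat_kernel B"
  proof
    fix v assume "v \<in> mat_kernel (B * B)"
    then have v: "v \<in> carrier_vec n" and BBv: "B *\<^sub>v (B *\<^sub>v v) = 0\<^sub>v n"
      using mat_kernelD[of "B * B" n n v] B by auto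
    have Bv: "B *\<^sub>v v \<in> carrier_vec n" using B v by simp
    have "(B *\<^sub>v v) \<bullet>c (B *\<^sub>v v) = 0"
      using transpose_vec_mult_scalar[OF B Bv v] sym BBv v by simp
    then have "B *\<^sub>v v = 0\<^sub>v n" by (simp only: conjugate_square_eq_0_vec[OF Bv])
    then show "v \<in> mat_kernel B" using mat_kernelI[OF B v] by simp
  qed
qed

text \<open>Meant for the Jordan block sizes of one eigenvalue, where the sum of
  \<open>min k n\<close> is the kernel dimension of the k-th power. If the second power adds
  nothing, no block is larger than 1.\<close>

lemma sum_list_min_2_eq_min_1:
  assumes "(\<Sum>n\<leftarrow>ns. min 2 n) = (\<Sum>n\<leftarrow>ns. min 1 n)"
  shows "sum_list ns = (\<Sum>n\<leftarrow>ns. min (1 :: nat) n)"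
  using assms
proof (induction ns)
  case (Cons m ns)
  \<comment> \<open>An excess in the head cannot be offset by the tail, so head and tail each attain
    equality.\<close>
  have "(\<Sum>n\<leftarrow>ns. min 1 n) \<le> (\<Sum>n\<leftarrow>ns. min (2 :: nat) n)" by (rule sum_list_mono) simp
  with Cons show ?case by (auto simp: min_def split: if_splits)
qed simp

text \<open>The order of the root is the total size of the Jordan blocks for \<open>e\<close>, the
  kernel dimension is their number, and all these blocks have size 1.\<close>

lemma order_char_poly_symmetric:
  fixes A :: "real mat"
  assumes A: "A \<in> carrier_mat n n" and sym: "A\<^sup>T = A"
  shows "Polynomial.order e (char_poly A) = kernel_dim (char_matrix A e)"
proof -
  let ?B = "char_matrix A e"
  have B: "?B \<in> carrier_mat n n" using A by simp
  have "?B\<^sup>T = ?B"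
    using A sym by (auto simp: char_matrix_def mat_eq_iff)
  then have "mat_kernel (?B * ?B) = mat_kernel ?B" by (rule mat_kernel_symmetric_square[OF B])
  then have dims: "dim_gen_eigenspace A e 2 = dim_gen_eigenspace A e 1"
    using B by (simp add: dim_gen_eigenspace_def kernel_dim_def numeral_2_eq_2)
  obtain as where "char_poly A = (\<Prod>a\<leftarrow>as. [:- a, 1:])"
    using char_poly_symmetric_splits[OF A sym] by blast
  from jordan_nf_exists[OF A this] obtain n_as where jnf: "jordan_nf A n_as" by blast
  let ?ns = "map fst [(n, a)\<leftarrow>n_as. a = e]"
  have "Polynomial.order e (char_poly A) = sum_list ?ns"
    by (simp add: jordan_nf_order[OF jnf] case_prod_unfold)
  also have "\<dots> = (\<Sum>n\<leftarrow>?ns. min 1 n)"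
    using dims by (intro sum_list_min_2_eq_min_1) (simp only: dim_gen_eigenspace[OF jnf])
  also have "\<dots> = dim_gen_eigenspace A e 1" by (rule dim_gen_eigenspace[OF jnf, symmetric])
  also have "\<dots> = kernel_dim ?B" using B by (simp add: dim_gen_eigenspace_def)
  finally show ?thesis .
qed

section \<open>Bases in echelon form\<close>

text \<open>The entries at the pivots \<open>c k\<close> form a triangular matrix with nonzero
  diagonal, which gives independence. By \<open>sep\<close> a kernel vector is determined by its
  pivot entries, so matching these by forward substitution gives spanning.\<close>

lemma (in kernel) echelon_basis:
  fixes x :: "nat \<Rightarrow> 'a vec" and c :: "nat \<Rightarrow> nat"
  assumes x: "\<And>k. k < m \<Longrightarrow> x k \<in> mat_kernel A"
    and c: "\<And>k. k < m \<Longrightarrow> c k < nc"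
    and diag: "\<And>k. k < m \<Longrightarrow> x k $ c k \<noteq> 0"
    and lower: "\<And>j k. j < k \<Longrightarrow> k < m \<Longrightarrow> x k $ c j = 0"
    and sep: "\<And>v. v \<in> mat_kernel A \<Longrightarrow> (\<And>k. k < m \<Longrightarrow> v $ c k = 0) \<Longrightarrow> v = 0\<^sub>v nc"
  shows "inj_on x {..<m}" "basis (x ` {..<m})" "dim = m"
proof -
  let ?X = "x ` {..<m}"
  have X: "?X \<subseteq> mat_kernel A" using x by auto
  have kc: "v \<in> carrier_vec nc" if "v \<in> mat_kernel A" for v using that mat_kernel[OF A] by auto
  show inj: "inj_on x {..<m}"
    by (rule linorder_inj_onI') (metis diag lower lessThan_iff)
  have "Ker.lin_indpt ?X"
  proof (rule Ker.finite_lin_indpt2)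
    show "finite ?X" "?X \<subseteq> mat_kernel A" using X by auto
  next
    fix a assume lc: "lincomb a ?X = 0\<^sub>v nc"
    have "a (x k) = 0" if "k < m" for k
      using that
    proof (induction k rule: less_induct)
      case (less k)
      have "0 = (\<Sum>w\<in>?X. a w * w $ c k)"
        using lincomb_index[OF c X, of k a] lc less.prems c by simp
      also have "\<dots> = (\<Sum>j<m. a (x j) * x j $ c k)" by (simp add: sum.reindex[OF inj])
      \<comment> \<open>Terms with \<open>j < k\<close> vanish by induction, those with
        \<open>j > k\<close> because \<open>x j\<close> is zero at the earlier pivot
        \<open>c k\<close>.\<close>
      also have "\<dots> = (\<Sum>j\<in>{k}. a (x j) * x j $ c k)"
        using less lower by (intro sum.mono_neutral_right) (auto simp: neq_iff)
      finally show ?case using diag[OF less.prems] by simp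
    qed
    then show "\<forall>v\<in>?X. a v = 0" by auto
  qed
  moreover have "span ?X = mat_kernel A"
  proof
    show "span ?X \<subseteq> mat_kernel A" using Ker.span_closed[OF X] by auto
    show "mat_kernel A \<subseteq> span ?X"
    proof
      fix v assume v: "v \<in> mat_kernel A"
      have "\<exists>w \<in> span ?X. \<forall>j<k. v $ c j = w $ c j" if "k \<le> m" for k
        using that
      proof (induction k)
        case 0
        show ?case using Ker.span_zero by auto
      next
        case (Suc k)
        then obtain w where w: "w \<in> span ?X" "\<forall>j<k. v $ c j = w $ c j" by auto
        have k: "k < m" using Suc.prems by simp
        \<comment> \<open>This multiple corrects the entry at pivot \<open>k\<close>; earlier pivots
          stay matched because \<open>x k\<close> vanishes there.\<close>
        define s where "s = (v $ c k - w $ c k) / x k $ c k"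
        have xk: "x k \<in> span ?X" using k by (intro Ker.span_mem[OF X]) simp
        then have "s \<cdot>\<^sub>v x k \<in> span ?X"
          using submodule.smult_closed[OF Ker.span_is_submodule[OF X]] by simp
        then have "w + s \<cdot>\<^sub>v x k \<in> span ?X" using Ker.span_add1[OF X w(1)] by simp
        moreover have "v $ c j = (w + s \<cdot>\<^sub>v x k) $ c j" if "j < Suc k" for j
          using that w(2) k lower diag[OF k] c kc[OF x[OF k]]
          by (auto simp: s_def less_Suc_eq)
        ultimately show ?case by blast
      qed
      then obtain w where w: "w \<in> span ?X" "\<forall>j<m. v $ c j = w $ c j" by blast
      have wK: "w \<in> mat_kernel A" using w Ker.span_closed[OF X] by auto
      have "v + (- 1) \<cdot>\<^sub>v w \<in> mat_kernel A"
        using v wK Ker.smult_closed[of "- 1" w] Ker.a_closed by simp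
      moreover have "(v + (- 1) \<cdot>\<^sub>v w) $ c k = 0" if "k < m" for k
        using that w c kc[OF v] kc[OF wK] by simp
      ultimately have 0: "v + (- 1) \<cdot>\<^sub>v w = 0\<^sub>v nc" by (rule sep)
      have "v = w"
      proof (rule eq_vecI)
        fix i assume "i < dim_vec w"
        then show "v $ i = w $ i" using arg_cong[OF 0, of "\<lambda>u. u $ i"] kc[OF v] kc[OF wK] by simp
      qed (use kc[OF v] kc[OF wK] in auto)
      then show "v \<in> span ?X" using w by simp
    qed
  qed
  ultimately show basis: "basis ?X" unfolding Ker.basis_def using X by auto
  show "dim = m" using Ker.dim_basis[OF _ basis] inj by (simp add: card_image)
qed

section \<open>Line sums on the board\<close>

abbreviation board :: "nat \<Rightarrow> (nat \<times> nat) set" where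
  "board n \<equiv> {1..n} \<times> {1..n}"

text \<open>Rows, columns, antidiagonals and diagonals are the level sets of these four functions.\<close>

definition line_keys :: "(nat \<times> nat \<Rightarrow> int) set" where
  "line_keys = {\<lambda>p. int (fst p), \<lambda>p. int (snd p), \<lambda>p. int (fst p) + int (snd p),
     \<lambda>p. int (fst p) - int (snd p)}"

definition balanced :: "nat \<Rightarrow> (nat \<times> nat \<Rightarrow> real) \<Rightarrow> bool" where
  "balanced n f \<longleftrightarrow> (\<forall>g\<in>line_keys. \<forall>c. (\<Sum>p | p \<in> board n \<and> g p = c. f p) = 0)"

lemma sum_line_keys:
  fixes h :: "(nat \<times> nat \<Rightarrow> int) \<Rightarrow> real"
  shows "(\<Sum>g\<in>line_keys. h g) = h (\<lambda>p. int (fst p)) + h (\<lambda>p. int (snd p))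
    + h (\<lambda>p. int (fst p) + int (snd p)) + h (\<lambda>p. int (fst p) - int (snd p))"
proof -
  have "(\<lambda>p::nat\<times>nat. int (fst p)) \<noteq> (\<lambda>p. int (snd p))"
       "(\<lambda>p::nat\<times>nat. int (fst p)) \<noteq> (\<lambda>p. int (fst p) + int (snd p))"
       "(\<lambda>p::nat\<times>nat. int (fst p)) \<noteq> (\<lambda>p. int (fst p) - int (snd p))"
       "(\<lambda>p::nat\<times>nat. int (snd p)) \<noteq> (\<lambda>p. int (fst p) + int (snd p))"
       "(\<lambda>p::nat\<times>nat. int (snd p)) \<noteq> (\<lambda>p. int (fst p) - int (snd p))"
       "(\<lambda>p::nat\<times>nat. int (fst p) + int (snd p)) \<noteq> (\<lambda>p. int (fst p) - int (snd p))"
    \<comment> \<open>At (1, 2) the four keys take the distinct values 1, 2, 3 and -1.\<close>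
    by (auto dest!: fun_cong[of _ _ "(1, 2)"])
  then show ?thesis unfolding line_keys_def by simp
qed

text \<open>Any two of the four keys determine a square, so distinct squares share at most one line,
  and a square shares all four with itself.\<close>

lemma sum_line_keys_indicator:
  assumes "p \<in> board n" "q \<in> board n"
  shows "(\<Sum>g\<in>line_keys. if g q = g p then 1 else 0)
    = (if (p, q) \<in> parcs (queens_graph n) then 1 else 0) + (if p = q then 4 else (0 :: real))"
  using assms unfolding sum_line_keys by (cases p; cases q) (auto simp: queens_graph_def)

section \<open>Adjacency matrix and functions on the board\<close>

lemma queens_mat_carrier: "queens_mat n \<in> carrier_mat (n ^ 2) (n ^ 2)"
  by (simp add: queens_mat_def)

lemma transpose_queens_mat: "(queens_mat n)\<^sup>T = queens_mat n"
  by (rule eq_matI) (auto simp: queens_mat_def queens_graph_def)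

lemma sum_square: "(\<Sum>k<n ^ 2. h (square n k)) = (\<Sum>p\<in>board n. h p)"
  using sum.reindex_bij_betw[OF bij_betw_square, of h n] by (simp add: queens_graph_def)

lemma square_in_board: "k < n ^ 2 \<Longrightarrow> square n k \<in> board n"
  using bij_betwE[OF bij_betw_square] by (auto simp: queens_graph_def)

lemma board_vec_eq_iff: "board_vec n f = board_vec n g \<longleftrightarrow> (\<forall>p\<in>board n. f p = g p)"
proof -
  have "board n = square n ` {..<n ^ 2}"
    using bij_betw_square[of n] by (auto simp: bij_betw_def queens_graph_def)
  then show ?thesis by (auto simp: board_vec_def vec_eq_iff)
qed

lemma board_vec_surj:
  assumes "v \<in> carrier_vec (n ^ 2)"
  obtains f where "v = board_vec n f"
proof
  let ?h = "\<lambda>p. v $ the_inv_into {..<n ^ 2} (square n) p"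
  have "the_inv_into {..<n ^ 2} (square n) (square n k) = k" if "k < n ^ 2" for k
    using that bij_betw_square[of n] by (intro the_inv_into_f_f) (auto simp: bij_betw_def)
  then show "v = board_vec n ?h" using assms by (auto simp: board_vec_def vec_eq_iff)
qed

text \<open>This is the adjacency matrix plus 4 applied to \<open>f\<close>: the square
  \<open>p\<close> itself is counted once on each of its four lines.\<close>

definition queens_sum :: "nat \<Rightarrow> (nat \<times> nat \<Rightarrow> real) \<Rightarrow> nat \<times> nat \<Rightarrow> real" where
  "queens_sum n f p = (\<Sum>g\<in>line_keys. \<Sum>q | q \<in> board n \<and> g q = g p. f q)"

lemma queens_mat_board_vec:
  "queens_mat n *\<^sub>v board_vec n f = board_vec n (\<lambda>p. queens_sum n f p - 4 * f p)"
proof (rule eq_vecI)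
  fix k assume "k < dim_vec (board_vec n (\<lambda>p. queens_sum n f p - 4 * f p))"
  then have k: "k < n ^ 2" by (simp add: board_vec_def)
  let ?p = "square n k"
  let ?a = "\<lambda>q. if (?p, q) \<in> parcs (queens_graph n) then 1 else (0 :: real)"
  have p: "?p \<in> board n" using square_in_board[OF k] .
  have "(queens_mat n *\<^sub>v board_vec n f) $ k = (\<Sum>l<n ^ 2. ?a (square n l) * f (square n l))"
    using k by (simp add: queens_mat_def board_vec_def scalar_prod_def atLeast0LessThan)
  also have "\<dots> = (\<Sum>q\<in>board n. ?a q * f q)" by (rule sum_square)
  also have "\<dots> = (\<Sum>q\<in>board n. (\<Sum>g\<in>line_keys. if g q = g ?p then f q else 0)
      - (if q = ?p then 4 * f q else 0))"
  proof (rule sum.cong[OF refl])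
    fix q assume "q \<in> board n"
    from sum_line_keys_indicator[OF p this]
    have "?a q = (\<Sum>g\<in>line_keys. if g q = g ?p then 1 else 0) - (if q = ?p then 4 else 0)" by auto
    also have "\<dots> * f q = (\<Sum>g\<in>line_keys. if g q = g ?p then f q else 0)
      - (if q = ?p then 4 * f q else 0)"
      by (auto simp: left_diff_distrib sum_distrib_right intro!: sum.cong)
    finally show "?a q * f q = \<dots>" .
  qed
  also have "\<dots> = queens_sum n f ?p - 4 * f ?p"
    using p unfolding sum_subtractf queens_sum_def
    by (subst sum.swap) (simp add: sum.inter_filter)
  finally show "(queens_mat n *\<^sub>v board_vec n f) $ k
      = board_vec n (\<lambda>p. queens_sum n f p - 4 * f p) $ k"
    using k by (simp add: board_vec_def)
qed (simp_all add: queens_mat_def board_vec_def)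

text \<open>The inner sum is constant on each level set of \<open>g\<close>, so each level set
  contributes its sum times itself.\<close>

lemma sum_mult_class_sum:
  fixes f :: "'a \<Rightarrow> real"
  assumes "finite V"
  shows "(\<Sum>p\<in>V. f p * (\<Sum>q | q \<in> V \<and> g q = g p. f q))
    = (\<Sum>c\<in>g ` V. (\<Sum>p | p \<in> V \<and> g p = c. f p)\<^sup>2)"
proof -
  have "(\<Sum>p\<in>V. f p * (\<Sum>q | q \<in> V \<and> g q = g p. f q))
    = (\<Sum>c\<in>g ` V. \<Sum>p | p \<in> V \<and> g p = c. f p * (\<Sum>q | q \<in> V \<and> g q = g p. f q))"
    by (rule sum.image_gen[OF assms])
  also have "\<dots> = (\<Sum>c\<in>g ` V. (\<Sum>p | p \<in> V \<and> g p = c. f p)\<^sup>2)"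
    by (intro sum.cong) (auto simp: power2_eq_square sum_distrib_right)
  finally show ?thesis .
qed

text \<open>For the converse, pairing \<open>f\<close> with \<open>queens_sum n f\<close> yields the
  sum of the squares of all line sums; if it is 0, every line sum is.\<close>

lemma balanced_iff_queens_sum:
  "balanced n f \<longleftrightarrow> (\<forall>p\<in>board n. queens_sum n f p = 0)"
proof
  assume "balanced n f"
  then show "\<forall>p\<in>board n. queens_sum n f p = 0"
    unfolding queens_sum_def balanced_def by (auto intro!: sum.neutral)
next
  assume 0: "\<forall>p\<in>board n. queens_sum n f p = 0"
  let ?s = "\<lambda>g c. \<Sum>p | p \<in> board n \<and> g p = c. f p"
  have fin: "finite line_keys" by (simp add: line_keys_def)
  have "0 = (\<Sum>p\<in>board n. f p * queens_sum n f p)"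
    using 0 by (intro sum.neutral[symmetric]) auto
  also have "\<dots> = (\<Sum>g\<in>line_keys. \<Sum>p\<in>board n. f p * ?s g (g p))"
    unfolding queens_sum_def sum_distrib_left by (rule sum.swap)
  also have "\<dots> = (\<Sum>g\<in>line_keys. \<Sum>c\<in>g ` board n. (?s g c)\<^sup>2)"
    by (intro sum.cong refl sum_mult_class_sum) simp
  finally have sq: "(\<Sum>g\<in>line_keys. \<Sum>c\<in>g ` board n. (?s g c)\<^sup>2) = 0" by simp
  show "balanced n f"
    unfolding balanced_def
  proof (intro ballI allI)
    fix g c assume g: "g \<in> line_keys"
    have "(\<Sum>c\<in>g ` board n. (?s g c)\<^sup>2) = 0"
      using sq g fin by (subst (asm) sum_nonneg_eq_0_iff) (auto intro: sum_nonneg)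
    then have "?s g c = 0" if "c \<in> g ` board n"
      using that by (subst (asm) sum_nonneg_eq_0_iff) auto
    \<comment> \<open>A level not attained on the board gives an empty sum.\<close>
    then show "?s g c = 0" by (cases "c \<in> g ` board n") (auto intro!: sum.neutral)
  qed
qed

lemma board_vec_in_eigenspace_iff:
  "board_vec n f \<in> eigenspace (queens_mat n) (- 4) \<longleftrightarrow> balanced n f"
proof -
  have "- 4 \<cdot>\<^sub>v board_vec n f = board_vec n (\<lambda>p. - 4 * f p)"
    by (simp add: board_vec_def vec_eq_iff)
  moreover have "board_vec n f \<in> carrier_vec (dim_row (queens_mat n))"
    by (simp add: board_vec_def queens_mat_def)
  ultimately show ?thesis
    by (simp add: eigenspace_def queens_mat_board_vec board_vec_eq_iff balanced_iff_queens_sum)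
qed

section \<open>Determination of balanced functions by their values at the pivot squares\<close>

lemma balanced_isolated:
  assumes "balanced n f" "g \<in> line_keys" "p \<in> board n"
    and "\<And>q. q \<in> board n \<Longrightarrow> q \<noteq> p \<Longrightarrow> g q = g p \<Longrightarrow> f q = 0"
  shows "f p = 0"
proof -
  have "0 = (\<Sum>q | q \<in> board n \<and> g q = g p. f q)" using assms by (simp add: balanced_def)
  also have "\<dots> = sum f {p}" using assms(3,4) by (intro sum.mono_neutral_right) auto
  finally show ?thesis by simp
qed

text \<open>First the rows are cleared from the top, then the last three rows are cleared column by column:
  in each step the ends of the row or strip are alone, among the squares not yet cleared, on a
  diagonal or antidiagonal, which leaves a single unknown value in the row or column.\<close>

lemma balanced_eq_zero:
  assumes f: "balanced n f" and n: "n \<ge> 4"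
    and 0: "\<And>a b. a \<in> {1..n - 3} \<Longrightarrow> b \<in> {1..n - 3} \<Longrightarrow> f (a, b + 1) = 0"
    and p: "p \<in> board n"
  shows "f p = 0"
proof -
  note isolated = balanced_isolated[OF f, unfolded line_keys_def]
  have row: "f (i, j) = 0" if "i \<in> {1..n - 3}" "j \<in> {1..n}" for i j
    using that
  proof (induction i arbitrary: j rule: less_induct)
    case (less i)
    have up: "f (i', j') = 0" if "1 \<le> i'" "i' < i" "j' \<in> {1..n}" for i' j'
      using that less by auto
    \<comment> \<open>After this only the columns 1, \<open>n - 1\<close> and \<open>n\<close> of
      row \<open>i\<close> remain open.\<close>
    have mid: "f (i, j') = 0" if "2 \<le> j'" "j' \<le> n - 2" for j'
    proof -
      have "j' - 1 \<in> {1..n - 3}" "j' - 1 + 1 = j'" using that n by auto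
      then show ?thesis using 0[of i "j' - 1"] less.prems by simp
    qed
    \<comment> \<open>All other squares on this antidiagonal have a larger column, hence lie in
      earlier rows.\<close>
    have first: "f (i, 1) = 0"
    proof (rule isolated[of "\<lambda>p. int (fst p) + int (snd p)"])
      fix q assume "q \<in> board n" "q \<noteq> (i, 1)"
        "int (fst q) + int (snd q) = int (fst (i, 1)) + int (snd (i, 1))"
      then have "q \<in> board n" "fst q < i" by (cases q; auto)+
      then show "f q = 0" using up by (cases q) auto
    qed (use less.prems n in auto)
    have last: "f (i, n) = 0"
    proof (rule isolated[of "\<lambda>p. int (fst p) - int (snd p)"])
      fix q assume "q \<in> board n" "q \<noteq> (i, n)"
        "int (fst q) - int (snd q) = int (fst (i, n)) - int (snd (i, n))"
      then have "q \<in> board n" "fst q < i" by (cases q; auto)+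
      then show "f q = 0" using up by (cases q) auto
    qed (use less.prems n in auto)
    have "f (i, n - 1) = 0"
    proof (rule isolated[of "\<lambda>p. int (fst p)"])
      fix q assume "q \<in> board n" "q \<noteq> (i, n - 1)" "int (fst q) = int (fst (i, n - 1))"
      then have "fst q = i" "snd q = 1 \<or> snd q = n \<or> 2 \<le> snd q \<and> snd q \<le> n - 2" by auto
      then show "f q = 0" using first last mid by (cases q) auto
    qed (use less.prems n in auto)
    moreover have "j = 1 \<or> j = n \<or> j = n - 1 \<or> 2 \<le> j \<and> j \<le> n - 2" using less.prems by auto
    ultimately show ?case using first last mid by blast
  qed
  have col: "\<forall>i\<in>{1..n}. f (i, j) = 0" if "j \<in> {1..n}" for j
    using that
  proof (induction j rule: less_induct)
    case (less j)
    have left: "f (i, j') = 0" if "i \<in> {1..n}" "1 \<le> j'" "j' < j" for i j'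
      using that less by auto
    \<comment> \<open>Upwards the antidiagonal leaves the last three rows; downwards it enters
      columns already cleared.\<close>
    have top: "f (n - 2, j) = 0"
    proof (rule isolated[of "\<lambda>p. int (fst p) + int (snd p)"])
      fix q assume "q \<in> board n" "q \<noteq> (n - 2, j)"
        "int (fst q) + int (snd q) = int (fst (n - 2, j)) + int (snd (n - 2, j))"
      then have "fst q \<in> {1..n - 3} \<and> snd q \<in> {1..n} \<or> fst q \<in> {1..n} \<and> 1 \<le> snd q \<and> snd q < j"
        using n by (cases q) auto
      then show "f q = 0" using row left by (cases q) auto
    qed (use less.prems n in auto)
    \<comment> \<open>From the last row the diagonal can only go up and to the left.\<close>
    have bottom: "f (n, j) = 0"
    proof (rule isolated[of "\<lambda>p. int (fst p) - int (snd p)"])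
      fix q assume "q \<in> board n" "q \<noteq> (n, j)"
        "int (fst q) - int (snd q) = int (fst (n, j)) - int (snd (n, j))"
      then have "q \<in> board n" "snd q < j" by (cases q; auto)+
      then show "f q = 0" using left by (cases q) auto
    qed (use less.prems n in auto)
    have "f (n - 1, j) = 0"
    proof (rule isolated[of "\<lambda>p. int (snd p)"])
      fix q assume "q \<in> board n" "q \<noteq> (n - 1, j)" "int (snd q) = int (snd (n - 1, j))"
      then have "snd q = j" "fst q = n - 2 \<or> fst q = n \<or> fst q \<in> {1..n - 3}" by auto
      then show "f q = 0" using row top bottom less.prems by (cases q) auto
    qed (use less.prems n in auto)
    moreover have "i = n - 2 \<or> i = n - 1 \<or> i = n \<or> i \<in> {1..n - 3}" if "i \<in> {1..n}" for i
      using that by auto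
    ultimately show ?case using top bottom row less.prems by blast
  qed
  show ?thesis using col p by (cases p) auto
qed

section \<open>The translates of the 4 by 4 pattern\<close>

definition X_fun :: "nat \<Rightarrow> nat \<Rightarrow> nat \<times> nat \<Rightarrow> real" where
  "X_fun a b = (\<lambda>(i, j). if i \<in> {a, a + 1, a + 2, a + 3} \<and> j \<in> {b, b + 1, b + 2, b + 3}
     then X4 (i - a + 1, j - b + 1) else 0)"

lemma X_vec_eq: "X_vec n (a, b) = board_vec n (X_fun a b)"
  by (simp add: X_vec_def X_fun_def)

lemma X_fun_nonzeroD: "X_fun a b (i, j) \<noteq> 0 \<Longrightarrow> i \<in> {a..a + 3} \<and> j \<in> {b..b + 3}"
  by (auto simp: X_fun_def split: if_splits)

lemma X_fun_shift: "i \<le> 3 \<Longrightarrow> j \<le> 3 \<Longrightarrow> X_fun a b (a + i, b + j) = X4 (i + 1, j + 1)"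
  by (auto simp: X_fun_def)

text \<open>Every line of \<open>X4\<close> holds as many entries 1 as -1. The keys are additive, so
  a translation only shifts their levels, and the bounds on \<open>a\<close> and \<open>b\<close>
  keep the whole pattern on the board.\<close>

lemma balanced_X_fun:
  assumes ab: "a \<in> {1..n - 3}" "b \<in> {1..n - 3}"
  shows "balanced n (X_fun a b)"
  unfolding balanced_def
proof (intro ballI allI)
  fix g c assume g: "g \<in> line_keys"
  define d where "d = c - g (a, b)"
  have shift: "g (a + i, b + j) = c \<longleftrightarrow> g (i, j) = d" for i j
    using g by (auto simp: line_keys_def d_def)
  have "(\<Sum>p | p \<in> board n \<and> g p = c. X_fun a b p)
      = (\<Sum>p\<in>board n. if g p = c then X_fun a b p else 0)"
    by (rule sum.inter_filter) simp
  also have "\<dots> = (\<Sum>p\<in>{a..a + 3} \<times> {b..b + 3}. if g p = c then X_fun a b p else 0)"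
    using ab by (intro sum.mono_neutral_right) (auto dest: X_fun_nonzeroD)
  also have "\<dots> = (\<Sum>(i, j)\<in>{0..3} \<times> {0..3}. if g (i, j) = d then X4 (i + 1, j + 1) else 0)"
    by (rule sum.reindex_bij_witness[symmetric,
          of _ "\<lambda>(i, j). (i - a, j - b)" "\<lambda>(i, j). (a + i, b + j)"])
       (simp_all add: case_prod_unfold mem_Times_iff shift X_fun_shift, linarith+)
  \<comment> \<open>The eight nonzero entries of \<open>X4\<close>, at zero-based offsets.\<close>
  also have "\<dots> = of_bool (g (0, 1) = d) + of_bool (g (1, 3) = d) + of_bool (g (2, 0) = d)
      + of_bool (g (3, 2) = d) - of_bool (g (0, 2) = d) - of_bool (g (1, 0) = d)
      - of_bool (g (2, 3) = d) - of_bool (g (3, 1) = d)"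
  proof -
    have "{0..3 :: nat} = {0, 1, 2, 3}" by auto
    then show ?thesis by (simp add: sum.cartesian_product' X4_def)
  qed
  also have "\<dots> = 0"
    using g unfolding line_keys_def by (elim insertE emptyE; simp)
  finally show "(\<Sum>p | p \<in> board n \<and> g p = c. X_fun a b p) = 0" .
qed

lemma X_fun_leading: "X_fun a b (a, b + 1) = 1"
  by (simp add: X_fun_def X4_def)

text \<open>The corner (1, 1) of \<open>X4\<close> is 0, so its first nonzero entry in lexicographic
  order is at (1, 2). This makes (a, b + 1) the pivot of the translate.\<close>

lemma X_fun_before_leading:
  assumes "a' < a \<or> a' = a \<and> b' < b"
  shows "X_fun a b (a', b' + 1) = 0"
  using assms by (auto simp: X_fun_def X4_def)

section \<open>The eigenvalue -4, its multiplicity and the basis\<close>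

theorem theorem4p3:
  fixes n :: nat
  assumes "n \<ge> 4"
  shows "eigenvalue (queens_mat n) (- 4)
    \<and> Polynomial.order (- 4) (char_poly (queens_mat n)) = (n - 3) ^ 2
    \<and> vectorspace.dim class_ring (eigenspace_module (queens_mat n) (- 4)) = (n - 3) ^ 2
    \<and> inj_on (X_vec n) ({1..n - 3} \<times> {1..n - 3})
    \<and> vectorspace.basis class_ring (eigenspace_module (queens_mat n) (- 4))
        (X_vec n ` ({1..n - 3} \<times> {1..n - 3}))"
proof -
  let ?A = "queens_mat n" and ?m = "n - 3"
  define K where "K = char_matrix ?A (- 4)"
  have carrier: "?A \<in> carrier_mat (n ^ 2) (n ^ 2)" by (rule queens_mat_carrier)
  have eig: "eigenspace ?A (- 4) = mat_kernel K"
    unfolding K_def by (rule eigenspace_eq_mat_kernel[OF carrier])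
  interpret kernel "n ^ 2" "n ^ 2" K using carrier by unfold_locales (simp add: K_def)
  have module: "eigenspace_module ?A (- 4) = VK" by (simp add: eig carrier_matD(1)[OF carrier])
  \<comment> \<open>Enumerating the pairs (a, b) row by row turns the order of indices into the
    lexicographic order.\<close>
  define x where "x = X_vec n \<circ> square ?m"
  \<comment> \<open>The zero-based position (a - 1) * n + b of the square (a, b + 1) on the full
    board, for the k-th pair (a, b).\<close>
  define c where "c k = k div ?m * n + (k mod ?m + 1)" for k
  have x_eq: "x k = board_vec n (X_fun (k div ?m + 1) (k mod ?m + 1))" for k
    by (simp add: x_def square_def X_vec_eq)
  have m: "k div ?m < ?m" "k mod ?m < ?m" if "k < ?m ^ 2" for k
    using that square_in_board[OF that] by (auto simp: square_def)
  have c_less: "c k < n ^ 2" if k: "k < ?m ^ 2" for k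
  proof -
    have "k mod ?m + 1 < n" using m(2)[OF k] by linarith
    then have "c k < (k div ?m + 1) * n" by (simp add: c_def)
    also have "\<dots> \<le> n * n" using m[OF k] by (intro mult_le_mono1) simp
    finally show ?thesis by (simp add: power2_eq_square)
  qed
  have entry: "board_vec n f $ c k = f (k div ?m + 1, k mod ?m + 1 + 1)" if k: "k < ?m ^ 2" for f k
  proof -
    \<comment> \<open>The column offset does not carry into the next row, so division by
      \<open>n\<close> recovers the square.\<close>
    have "k mod ?m + 1 < n" using m(2)[OF k] by linarith
    moreover have "(q * n + r) div n = q" "(q * n + r) mod n = r" if "r < n" for q r
      using that by auto
    ultimately have "square n (c k) = (k div ?m + 1, k mod ?m + 1 + 1)"
      unfolding square_def c_def by metis
    then show ?thesis using c_less[OF k] by (simp add: board_vec_def)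
  qed
  have xK: "x k \<in> mat_kernel K" if "k < ?m ^ 2" for k
    using m[OF that] unfolding eig[symmetric] x_eq board_vec_in_eigenspace_iff
    by (intro balanced_X_fun) (auto simp: Suc_le_eq)
  have diag: "x k $ c k \<noteq> 0" if "k < ?m ^ 2" for k
    unfolding x_eq entry[OF that] X_fun_leading by simp
  have lower: "x k $ c j = 0" if jk: "j < k" "k < ?m ^ 2" for j k
  proof -
    have "j div ?m < k div ?m \<or> j div ?m = k div ?m \<and> j mod ?m < k mod ?m"
      using jk(1) div_le_mono[of j k ?m] div_mult_mod_eq[of j ?m] div_mult_mod_eq[of k ?m]
      by (metis less_imp_le nat_add_left_cancel_less order_le_less)
    moreover have "x k $ c j
        = X_fun (k div ?m + 1) (k mod ?m + 1) (j div ?m + 1, j mod ?m + 1 + 1)"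
      unfolding x_eq using jk by (intro entry) simp
    ultimately show ?thesis by (simp only: X_fun_before_leading add_less_cancel_right add_right_cancel)
  qed
  have sep: "v = 0\<^sub>v (n ^ 2)"
    if v: "v \<in> mat_kernel K" and 0: "\<And>k. k < ?m ^ 2 \<Longrightarrow> v $ c k = 0" for v
  proof -
    have "v \<in> carrier_vec (n ^ 2)" by (rule mat_kernelD(1)[OF A v])
    then obtain f where f: "v = board_vec n f" by (rule board_vec_surj)
    have bal: "balanced n f" using v unfolding f eig[symmetric] board_vec_in_eigenspace_iff .
    have "f (a, b + 1) = 0" if "a \<in> {1..?m}" "b \<in> {1..?m}" for a b
    proof -
      have "(a, b) \<in> square ?m ` {..<?m ^ 2}"
        using that bij_betw_imp_surj_on[OF bij_betw_square] by (simp add: queens_graph_def)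
      then obtain k where "k < ?m ^ 2" "a = k div ?m + 1" "b = k mod ?m + 1"
        by (auto simp: square_def)
      then show ?thesis using 0[of k] entry[of k f] by (simp add: f)
    qed
    then have "\<forall>p\<in>board n. f p = 0" using balanced_eq_zero[OF bal assms] by blast
    then have "v = board_vec n (\<lambda>_. 0)" by (simp add: f board_vec_eq_iff)
    then show ?thesis by (simp add: board_vec_def vec_eq_iff)
  qed
  have basis: "inj_on x {..<?m ^ 2}" "basis (x ` {..<?m ^ 2})" "dim = ?m ^ 2"
    by (rule echelon_basis[of "?m ^ 2" x c]; fact xK c_less diag lower sep)+
  have sq: "square ?m ` {..<?m ^ 2} = board ?m"
    using bij_betw_imp_surj_on[OF bij_betw_square[of ?m]] by (simp add: queens_graph_def)
  have "0 < ?m ^ 2" using assms by simp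
  \<comment> \<open>As \<open>n\<close> is at least 4, index 0 is available, and \<open>x 0\<close>
    is nonzero at its pivot.\<close>
  then have "eigenvector ?A (x 0) (- 4)"
    using xK[of 0] diag[of 0] c_less[of 0] carrier
    by (auto simp: eig[symmetric] eigenspace_def eigenvector_def)
  moreover have "Polynomial.order (- 4) (char_poly ?A) = ?m ^ 2"
    using order_char_poly_symmetric[OF carrier transpose_queens_mat] basis(3)
    by (simp add: K_def[symmetric])
  moreover have "inj_on (X_vec n) (board ?m)"
    using basis(1) unfolding x_def sq[symmetric] by (rule inj_on_imageI)
  moreover have "x ` {..<?m ^ 2} = X_vec n ` board ?m"
    unfolding x_def image_comp[symmetric] sq ..
  ultimately show ?thesis using basis(2,3) unfolding module eigenvalue_def by auto
qed

end
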